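(* Every locally compact abelian group $G$ is approximable by finite loops.
   Context: A quasigroup is a set $Q$ with a binary operation $\circ$ such that for all $a,b\in Q$ each of $a\circ x=b$, $x\circ a=b$ has exactly one solution; a loop is a quasigroup having an element $e_Q$ with $a\circ e_Q=e_Q\circ a=a$ for all $a$. For a locally compact group $G$ with identity $e$, a compact $C\subseteq G$ and a neighborhood $U$ of $e$, a $(C,U)$-approximation by a finite loop is a pair $(Q,j)$ with $(Q,\circ)$ a finite loop and $j:Q\to G$ injective such that (a) $C\subseteq j(Q)U$ and (b) for all $a,b\in Q$ with $j(a),j(b)\in C$, $(j(a)j(b))^{-1}j(a\circ b)\in U$. $G$ is approximable by finite loops if such an approximation exists for every compact $C$ and every neighborhood $U$ of $e$. *)

theory Defs
  imports "HOL-Analysis.Analysis"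
begin

definition is_loop :: "'q set \<Rightarrow> ('q \<Rightarrow> 'q \<Rightarrow> 'q) \<Rightarrow> bool" where
  "is_loop Q op \<longleftrightarrow>
     (\<forall>a\<in>Q. \<forall>b\<in>Q. op a b \<in> Q) \<and>
     (\<forall>a\<in>Q. \<forall>b\<in>Q. \<exists>!x. x \<in> Q \<and> op a x = b) \<and>
     (\<forall>a\<in>Q. \<forall>b\<in>Q. \<exists>!x. x \<in> Q \<and> op x a = b) \<and>
     (\<exists>e\<in>Q. \<forall>a\<in>Q. op a e = a \<and> op e a = a)"

definition is_nhd :: "'a::topological_space set \<Rightarrow> 'a \<Rightarrow> bool" where
  "is_nhd U x \<longleftrightarrow> (\<exists>V. open V \<and> x \<in> V \<and> V \<subseteq> U)"

definition loop_approximation ::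
  "'a::{topological_space, group_add} set \<Rightarrow> 'a set \<Rightarrow> 'q set \<Rightarrow> ('q \<Rightarrow> 'q \<Rightarrow> 'q) \<Rightarrow> ('q \<Rightarrow> 'a) \<Rightarrow> bool" where
  "loop_approximation C U Q op j \<longleftrightarrow>
     finite Q \<and> is_loop Q op \<and> inj_on j Q \<and>
     C \<subseteq> {x + u | x u. x \<in> j ` Q \<and> u \<in> U} \<and>
     (\<forall>a\<in>Q. \<forall>b\<in>Q. j a \<in> C \<and> j b \<in> C \<longrightarrow> - (j a + j b) + j (op a b) \<in> U)"

text \<open>Finite loops are represented on subsets of nat (every finite loop is isomorphic to one).\<close>
definition approximable_by_finite_loops :: "'a::{topological_space, group_add} itself \<Rightarrow> bool" where
  "approximable_by_finite_loops _ \<longleftrightarrow>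
     (\<forall>C U. compact (C::'a set) \<and> is_nhd U 0 \<longrightarrow>
        (\<exists>(Q::nat set) op j. loop_approximation C U Q op j))"

end

theory Submission
  imports Defs "HOL-Library.Function_Algebras"
begin

text \<open>
  Choose a finite set \<open>F\<close> that is \<open>U\<close>-dense in \<open>C\<close> and a maximal \<open>S \<subseteq> F\<close> for which the
  homomorphism \<open>\<int>\<^sup>S \<rightarrow> G\<close> is injective with discrete image \<open>L\<close>. By maximality every \<open>g \<in> F - S\<close>
  is recurrent modulo \<open>L\<close>: for any neighbourhood \<open>V\<close> of \<open>0\<close> some multiple \<open>M g\<close> lies in \<open>L + V\<close>.
  Imposing these approximate relations on \<open>\<int>\<^sup>F\<close>, together with \<open>N s = 0\<close> for \<open>s \<in> S\<close> and a large
  \<open>N\<close>, gives a finite abelian group. Adding two representatives reduced off \<open>S\<close> carries at most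
  once in each coordinate, so the homomorphism \<open>\<int>\<^sup>F \<rightarrow> G\<close> changes by at most \<open>card F\<close> elements of
  \<open>V\<close>; and \<open>N L\<close> avoids the nonzero elements of a given compact set, so representatives with
  image near \<open>C\<close> are unambiguous. The resulting map into \<open>G\<close> need not be injective: if \<open>G\<close> is not
  discrete, it is perturbed to an injective one, and if \<open>G\<close> is discrete, one takes \<open>V = {0}\<close> and
  also divides by the kernel of \<open>\<int>\<^sup>F \<rightarrow> G\<close>.
\<close>

section \<open>Integer combinations in abelian groups\<close>

text \<open>One of the two sums is always empty, so this is the usual integer multiple, and
  additivity in \<open>x\<close> is immediate.\<close>

definition int_mult :: "int \<Rightarrow> 'a::ab_group_add \<Rightarrow> 'a" where
  "int_mult n x = (\<Sum>i<nat n. x) - (\<Sum>i<nat (- n). x)"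

lemma int_mult_0: "int_mult 0 x = 0"
  by (simp add: int_mult_def)

lemma int_mult_add_1: "int_mult (n + 1) x = int_mult n x + x"
proof (cases "n \<ge> 0")
  case True
  then have "nat (n + 1) = Suc (nat n)" "nat (- n) = 0" "nat (- (n + 1)) = 0" by auto
  then show ?thesis by (simp add: int_mult_def algebra_simps)
next
  case False
  then have "nat (- n) = Suc (nat (- (n + 1)))" "nat n = 0" "nat (n + 1) = 0" by auto
  then show ?thesis by (simp add: int_mult_def algebra_simps)
qed

lemma int_mult_diff_1: "int_mult (n - 1) x = int_mult n x - x"
  using int_mult_add_1[of "n - 1" x] by simp

lemma int_mult_add_left: "int_mult (m + n) x = int_mult m x + int_mult n x"
proof (induction n rule: int_induct[where k = 0])
  case base
  then show ?case by (simp add: int_mult_0)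
next
  case (step1 i)
  then show ?case using int_mult_add_1[of "m + i" x] int_mult_add_1[of i x]
    by (simp add: algebra_simps)
next
  case (step2 i)
  have "int_mult (m + (i - 1)) x = int_mult (m + i) x - x"
    using int_mult_diff_1[of "m + i" x] by (simp add: algebra_simps)
  with step2 show ?case by (simp add: int_mult_diff_1)
qed

lemma int_mult_add_right: "int_mult n (x + y) = int_mult n x + int_mult n y"
  by (simp add: int_mult_def sum.distrib)

lemma int_mult_mult: "int_mult m (int_mult n x) = int_mult (m * n) x"
proof (induction m rule: int_induct[where k = 0])
  case base
  then show ?case by (simp add: int_mult_0)
next
  case (step1 i)
  then show ?case by (simp add: int_mult_add_1 distrib_right int_mult_add_left[of "i * n" n])
next
  case (step2 i)
  have "int_mult ((i - 1) * n + n) x = int_mult ((i - 1) * n) x + int_mult n x"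
    by (rule int_mult_add_left)
  with step2 show ?case by (simp add: int_mult_diff_1 algebra_simps)
qed

text \<open>Every abelian group is a module over the integers; this supplies the distributive laws
  over finite sums.\<close>

interpretation int_mult: module int_mult
proof
  show "int_mult 1 x = x" for x :: 'a
    using int_mult_add_1[of 0 x] by (simp add: int_mult_0)
qed (simp_all add: int_mult_add_right int_mult_add_left int_mult_mult)

text \<open>For finite \<open>S\<close> this is the free abelian group on \<open>S\<close>, encoded
  by functions on the whole type so that it is literally a subgroup of \<open>supported F\<close>
  whenever \<open>S \<subseteq> F\<close>.\<close>

definition supported :: "'a set \<Rightarrow> ('a \<Rightarrow> int) set" where
  "supported S = {x. \<forall>g. g \<notin> S \<longrightarrow> x g = 0}"

text \<open>The evaluation homomorphism from the free group on \<open>F\<close>; the same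
  \<open>F\<close> is kept for vectors supported on a smaller set.\<close>

definition int_comb :: "'a::ab_group_add set \<Rightarrow> ('a \<Rightarrow> int) \<Rightarrow> 'a" where
  "int_comb F x = (\<Sum>g\<in>F. int_mult (x g) g)"

lemma supported_0: "0 \<in> supported S"
  by (simp add: supported_def)

lemma supported_diff: "x \<in> supported S \<Longrightarrow> y \<in> supported S \<Longrightarrow> x - y \<in> supported S"
  by (simp add: supported_def)

lemma supported_add: "x \<in> supported S \<Longrightarrow> y \<in> supported S \<Longrightarrow> x + y \<in> supported S"
  by (simp add: supported_def)

lemma supported_mono: "S \<subseteq> T \<Longrightarrow> supported S \<subseteq> supported T"
  by (auto simp: supported_def)

lemma int_comb_0: "int_comb F 0 = 0"
  by (simp add: int_comb_def)

lemma int_comb_add: "int_comb F (x + y) = int_comb F x + int_comb F y"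
  by (simp add: int_comb_def int_mult.scale_left_distrib sum.distrib)

lemma int_comb_diff: "int_comb F (x - y) = int_comb F x - int_comb F y"
  by (simp add: int_comb_def int_mult.scale_left_diff_distrib sum_subtractf)

lemma int_comb_single:
  assumes "finite F" "g \<in> F"
  shows "int_comb F (\<lambda>h. if h = g then m else 0) = int_mult m g"
proof -
  have "int_comb F (\<lambda>h. if h = g then m else 0) = (\<Sum>h\<in>F. if h = g then int_mult m g else 0)"
    unfolding int_comb_def by (rule sum.cong) auto
  with assms show ?thesis by simp
qed

section \<open>Relation vectors and division with remainder\<close>

text \<open>For finite \<open>F\<close> and \<open>c\<close> supported on \<open>F\<close>, this is
  the combination, with coefficients \<open>c\<close>, of the relation vectors "\<open>M h\<close>
  times the unit vector at \<open>h\<close>, minus \<open>l h\<close>".\<close>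

definition relator ::
  "'a set \<Rightarrow> ('a \<Rightarrow> int) \<Rightarrow> ('a \<Rightarrow> 'a \<Rightarrow> int) \<Rightarrow> ('a \<Rightarrow> int) \<Rightarrow> 'a \<Rightarrow> int" where
  "relator F M l c = (\<lambda>g. M g * c g - (\<Sum>h\<in>F. c h * l h g))"

lemma relator_diff: "relator F M l (c - d) = relator F M l c - relator F M l d"
  by (auto simp: relator_def fun_eq_iff algebra_simps sum_subtractf)

lemma relator_0: "relator F M l 0 = 0"
  by (auto simp: relator_def fun_eq_iff)

lemma relator_supported:
  assumes "c \<in> supported F" "\<And>h. h \<in> F \<Longrightarrow> l h \<in> supported F"
  shows "relator F M l c \<in> supported F"
  using assms by (auto simp: supported_def relator_def intro!: sum.neutral)

text \<open>By exchanging two sums. Reduction by a relator thus moves the image only by multiples of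
  the defects of the single relations.\<close>

lemma int_comb_relator:
  assumes "finite F"
  shows "int_comb F (relator F M l c) =
    (\<Sum>h\<in>F. int_mult (c h) (int_mult (M h) h - int_comb F (l h)))"
proof -
  have "int_comb F (relator F M l c) =
    (\<Sum>g\<in>F. int_mult (M g * c g) g) - (\<Sum>g\<in>F. \<Sum>h\<in>F. int_mult (c h * l h g) g)"
    by (simp add: int_comb_def relator_def int_mult.scale_left_diff_distrib
        int_mult.scale_sum_left sum_subtractf)
  also have "(\<Sum>g\<in>F. \<Sum>h\<in>F. int_mult (c h * l h g) g) = (\<Sum>h\<in>F. int_mult (c h) (int_comb F (l h)))"
    by (subst sum.swap) (simp add: int_comb_def int_mult.scale_sum_right)
  finally show ?thesis
    by (simp add: int_mult.scale_right_diff_distrib sum_subtractf mult.commute)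
qed

text \<open>The relations are triangular: one off \<open>S\<close> changes its own coordinate and
  coordinates in \<open>S\<close>, one in \<open>S\<close> only its own. Dividing with remainder
  first off \<open>S\<close> and then in \<open>S\<close> brings every vector into the box, so the
  quotient by the relations is finite.\<close>

lemma relator_box:
  assumes "finite F" "S \<subseteq> F" and M: "\<And>g. g \<in> F \<Longrightarrow> M g > 0"
    and l: "\<And>g. g \<in> F \<Longrightarrow> l g \<in> supported S" and l0: "\<And>s. s \<in> S \<Longrightarrow> l s = 0"
    and x: "x \<in> supported F"
  shows "\<exists>c\<in>supported F. \<forall>g\<in>F. 0 \<le> (x - relator F M l c) g \<and> (x - relator F M l c) g < M g"
proof -
  \<comment> \<open>Off \<open>S\<close> the quotient is taken at once; in \<open>S\<close> it is
    taken after adding the shifts \<open>l h\<close> caused by the reductions off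
    \<open>S\<close>.\<close>
  define c where "c g = (if g \<in> S then (x g + (\<Sum>h\<in>F - S. (x h div M h) * l h g)) div M g
    else if g \<in> F then x g div M g else 0)" for g
  have sum: "(\<Sum>h\<in>F. c h * l h g) = (\<Sum>h\<in>F - S. (x h div M h) * l h g)" for g
  proof -
    have "(\<Sum>h\<in>F. c h * l h g) = (\<Sum>h\<in>F - S. c h * l h g)"
      using assms by (intro sum.mono_neutral_right) auto
    also have "\<dots> = (\<Sum>h\<in>F - S. (x h div M h) * l h g)"
      by (rule sum.cong) (auto simp: c_def)
    finally show ?thesis .
  qed
  have "(x - relator F M l c) g = (if g \<in> S then (x g + (\<Sum>h\<in>F - S. (x h div M h) * l h g)) mod M g
      else x g mod M g)" if "g \<in> F" for g
  proof (cases "g \<in> S")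
    case True
    then have "c g = (x g + (\<Sum>h\<in>F - S. (x h div M h) * l h g)) div M g" by (simp add: c_def)
    with True show ?thesis by (simp add: relator_def sum minus_mult_div_eq_mod[symmetric])
  next
    case False
    then have "(\<Sum>h\<in>F. c h * l h g) = 0"
      using l by (intro sum.neutral) (auto simp: supported_def)
    with False that show ?thesis by (simp add: relator_def c_def minus_mult_div_eq_mod[symmetric])
  qed
  moreover have "c \<in> supported F"
    using assms(2) by (auto simp: supported_def c_def)
  ultimately show ?thesis
    using M by (intro bexI[of _ c]) auto
qed

lemma finite_box:
  assumes "finite F"
  shows "finite {b \<in> supported F. \<forall>g\<in>F. 0 \<le> b g \<and> b g < (M g :: int)}"
proof -
  have "finite {f. \<forall>x. (x \<in> F \<longrightarrow> f x \<in> (\<Union>g\<in>F. {0..<M g})) \<and> (x \<notin> F \<longrightarrow> f x = 0)}"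
    using assms by (intro finite_set_of_finite_funs) auto
  then show ?thesis
    by (rule rev_finite_subset) (auto simp: supported_def)
qed

section \<open>Neighbourhoods of zero\<close>

lemma nhd_zero_halving:
  fixes W :: "'a::topological_ab_group_add set"
  assumes "open W" "0 \<in> W"
  obtains V where "open V" "0 \<in> V" "\<And>x. x \<in> V \<Longrightarrow> - x \<in> V"
    "\<And>x y. x \<in> V \<Longrightarrow> y \<in> V \<Longrightarrow> x + y \<in> W"
proof -
  have "open ((\<lambda>p. fst p + snd p) -` W)"
    using assms(1) by (intro open_vimage continuous_intros)
  moreover have "(0, 0) \<in> (\<lambda>p. fst p + snd p) -` W" using assms by simp
  ultimately obtain A B where AB: "open A" "open B" "(0, 0) \<in> A \<times> B"
    "A \<times> B \<subseteq> (\<lambda>p. fst p + snd p) -` W"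
    by (rule open_prod_elim)
  define V where "V = A \<inter> B \<inter> uminus -` (A \<inter> B)"
  have "open V" unfolding V_def using AB by (intro open_Int open_vimage continuous_intros)
  moreover have "x + y \<in> W" if "x \<in> V" "y \<in> V" for x y
    using that AB(4) by (auto simp: V_def)
  ultimately show thesis using AB(3) by (intro that[of V]) (auto simp: V_def)
qed

text \<open>By induction with halving: a neighbourhood \<open>H\<close> whose pairwise sums lie in
  \<open>W\<close> takes both the new summand and the sum of the others.\<close>

lemma nhd_zero_sum:
  fixes W :: "'a::topological_ab_group_add set"
  assumes "finite I" "open W" "0 \<in> W"
  shows "\<exists>V. open V \<and> 0 \<in> V \<and> (\<forall>x\<in>V. - x \<in> V) \<and>
    (\<forall>v. (\<forall>i\<in>I. v i \<in> V) \<longrightarrow> (\<Sum>i\<in>I. v i) \<in> W)"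
  using assms
proof (induction I arbitrary: W rule: finite_induct)
  case empty
  obtain V where "open V" "0 \<in> V" "\<And>x. x \<in> V \<Longrightarrow> - x \<in> V"
    by (rule nhd_zero_halving[OF empty]) blast
  with empty show ?case by auto
next
  case (insert a I)
  obtain H where H: "open H" "0 \<in> H" "\<And>x. x \<in> H \<Longrightarrow> - x \<in> H"
    "\<And>x y. x \<in> H \<Longrightarrow> y \<in> H \<Longrightarrow> x + y \<in> W"
    by (rule nhd_zero_halving[OF insert.prems]) blast
  obtain V where V: "open V" "0 \<in> V" "\<forall>x\<in>V. - x \<in> V"
    "\<forall>v. (\<forall>i\<in>I. v i \<in> V) \<longrightarrow> (\<Sum>i\<in>I. v i) \<in> H"
    using insert.IH[OF H(1,2)] by blast
  show ?case
    using H V insert.hyps by (intro exI[of _ "V \<inter> H"]) (auto simp: open_Int)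
qed

lemma open_minus_vimage:
  fixes W :: "'a::topological_ab_group_add set"
  assumes "open W"
  shows "open {x. x - a \<in> W}"
proof -
  have "open ((\<lambda>x. x - a) -` W)"
    using assms by (intro open_vimage continuous_intros)
  then show ?thesis by (simp add: vimage_def)
qed

lemma compact_finite_net:
  fixes C :: "'a::topological_ab_group_add set"
  assumes "compact C" "open W" "0 \<in> W"
  obtains F where "finite F" "F \<subseteq> C" "\<And>x. x \<in> C \<Longrightarrow> \<exists>f\<in>F. x - f \<in> W"
proof -
  obtain F where "F \<subseteq> C" "finite F" "C \<subseteq> (\<Union>f\<in>F. {x. x - f \<in> W})"
    by (rule compactE_image[OF assms(1), of C "\<lambda>f. {x. x - f \<in> W}"])
      (use assms open_minus_vimage in auto)
  then show thesis by (intro that[of F]) auto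
qed

lemma compact_set_plus:
  fixes A B :: "'a::topological_ab_group_add set"
  assumes "compact A" "compact B"
  shows "compact {x + y | x y. x \<in> A \<and> y \<in> B}"
proof -
  have "compact ((\<lambda>p. fst p + snd p) ` (A \<times> B))"
    using assms by (intro compact_continuous_image compact_Times continuous_intros)
  moreover have "(\<lambda>p. fst p + snd p) ` (A \<times> B) = {x + y | x y. x \<in> A \<and> y \<in> B}"
    by force
  ultimately show ?thesis by simp
qed

lemma compact_set_minus:
  fixes A B :: "'a::topological_ab_group_add set"
  assumes "compact A" "compact B"
  shows "compact {x - y | x y. x \<in> A \<and> y \<in> B}"
proof -
  have "compact ((\<lambda>p. fst p - snd p) ` (A \<times> B))"
    using assms by (intro compact_continuous_image compact_Times continuous_intros)
  moreover have "(\<lambda>p. fst p - snd p) ` (A \<times> B) = {x - y | x y. x \<in> A \<and> y \<in> B}"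
    by force
  ultimately show ?thesis by simp
qed

section \<open>Discrete free subgroups and recurrence\<close>

text \<open>Since \<open>0\<close> is the only relation in a neighbourhood, this says at once that \<open>S\<close> is
  independent and that the subgroup it generates is discrete.\<close>

definition discretely_independent :: "'a::topological_ab_group_add set \<Rightarrow> 'a set \<Rightarrow> bool" where
  "discretely_independent F S \<longleftrightarrow>
    (\<exists>W. open W \<and> 0 \<in> W \<and> (\<forall>y\<in>supported S. int_comb F y \<in> W \<longrightarrow> y = 0))"

text \<open>Two such vectors whose images are close to the same point of a finite net of
  \<open>D\<close> have a difference with image in \<open>W\<close>, so they coincide. Hence there
  are at most as many vectors as net points.\<close>

lemma discretely_independent_finite_compact:
  fixes D :: "'a::topological_ab_group_add set"
  assumes "discretely_independent F S" "compact D"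
  shows "finite {y \<in> supported S. int_comb F y \<in> D}"
proof -
  obtain W where W: "open W" "0 \<in> W" "\<And>y. y \<in> supported S \<Longrightarrow> int_comb F y \<in> W \<Longrightarrow> y = 0"
    using assms(1) unfolding discretely_independent_def by blast
  obtain H where H: "open H" "0 \<in> H" "\<And>x. x \<in> H \<Longrightarrow> - x \<in> H"
    "\<And>x y. x \<in> H \<Longrightarrow> y \<in> H \<Longrightarrow> x + y \<in> W"
    by (rule nhd_zero_halving[OF W(1,2)]) blast
  obtain N where N: "finite N" "\<And>x. x \<in> D \<Longrightarrow> \<exists>f\<in>N. x - f \<in> H"
    by (rule compact_finite_net[OF assms(2) H(1,2)]) blast
  obtain p where p: "\<And>x. x \<in> D \<Longrightarrow> p x \<in> N \<and> x - p x \<in> H"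
    using N(2) by metis
  show ?thesis
  proof (rule inj_on_finite[OF _ _ N(1)])
    show "inj_on (\<lambda>y. p (int_comb F y)) {y \<in> supported S. int_comb F y \<in> D}"
    proof (rule inj_onI, clarify)
      fix y z assume *: "y \<in> supported S" "int_comb F y \<in> D" "z \<in> supported S" "int_comb F z \<in> D"
        "p (int_comb F y) = p (int_comb F z)"
      then have "int_comb F y - p (int_comb F y) + - (int_comb F z - p (int_comb F z)) \<in> W"
        using p H by blast
      then have "int_comb F (y - z) \<in> W" using *(5) by (simp add: int_comb_diff)
      then have "y - z = 0" using W(3) * supported_diff by blast
      then show "y = z" by simp
    qed
    show "(\<lambda>y. p (int_comb F y)) ` {y \<in> supported S. int_comb F y \<in> D} \<subseteq> N"
      using p by auto
  qed
qed

text \<open>Failure of discrete independence for \<open>insert g S\<close> yields nonzero vectors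
  with arbitrarily small image. Their coordinate at \<open>g\<close> cannot vanish, because
  \<open>S\<close> is discretely independent, and so it provides a recurring multiple of
  \<open>g\<close>.\<close>

lemma discretely_independent_recurrence:
  fixes V :: "'a::topological_ab_group_add set"
  assumes F: "finite F" "S \<subseteq> F" "g \<in> F" "g \<notin> S" and S: "discretely_independent F S"
    and max: "\<not> discretely_independent F (insert g S)" and V: "open V" "0 \<in> V"
  shows "\<exists>m l. m \<ge> 2 \<and> l \<in> supported S \<and> int_mult m g - int_comb F l \<in> V"
proof -
  obtain H where H: "open H" "0 \<in> H" "\<And>x. x \<in> H \<Longrightarrow> - x \<in> H"
    "\<And>x y. x \<in> H \<Longrightarrow> y \<in> H \<Longrightarrow> x + y \<in> V"
    by (rule nhd_zero_halving[OF V]) blast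
  obtain W where W: "open W" "0 \<in> W" "\<And>y. y \<in> supported S \<Longrightarrow> int_comb F y \<in> W \<Longrightarrow> y = 0"
    using S unfolding discretely_independent_def by blast
  \<comment> \<open>\<open>W\<close> excludes vectors supported on \<open>S\<close>, and
    \<open>H\<close> leaves room for doubling.\<close>
  have "open (W \<inter> H)" "0 \<in> W \<inter> H" using W H by auto
  then obtain y where y: "y \<in> supported (insert g S)" "int_comb F y \<in> W \<inter> H" "y \<noteq> 0"
    using max unfolding discretely_independent_def by blast
  have y0: "y g \<noteq> 0"
  proof
    assume "y g = 0"
    then have "y \<in> supported S" using y(1) by (auto simp: supported_def)
    then show False using W(3) y by blast
  qed
  define z where "z = (if y g > 0 then y else - y)"
  have z: "z \<in> supported (insert g S)" "int_comb F z \<in> H" "z g > 0"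
    using y y0 H(3) int_comb_diff[of F 0 y]
    by (auto simp: z_def supported_def int_comb_0)
  \<comment> \<open>The part of \<open>z\<close> off \<open>g\<close>, moved to the other side with
    opposite sign.\<close>
  define l where "l = (\<lambda>h. if h = g then z g else 0) - z"
  have l: "l \<in> supported S" using z(1) by (auto simp: l_def supported_def)
  have eq: "int_mult (z g) g - int_comb F l = int_comb F z"
    using F by (simp add: l_def int_comb_diff int_comb_single)
  \<comment> \<open>Doubling turns a positive coefficient into one of at least 2, which later lets
    unit vectors count as reduced.\<close>
  have "int_mult (z g + z g) g - int_comb F (l + l) = int_comb F z + int_comb F z"
    unfolding int_mult_add_left int_comb_add eq[symmetric] by (simp add: algebra_simps)
  also have "\<dots> \<in> V" using H(4) z(2) by blast
  finally show ?thesis using l z(3) supported_add[OF l l]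
    by (intro exI[of _ "z g + z g"] exI[of _ "l + l"]) auto
qed

text \<open>For a maximal discretely independent \<open>S\<close>, recurrence supplies the relations
  off \<open>S\<close>, while on \<open>S\<close> a large modulus keeps nonzero images out of
  \<open>D\<close>.\<close>

lemma exists_relations:
  fixes V D :: "'a::topological_ab_group_add set"
  assumes F: "finite F" and V: "open V" "0 \<in> V" and D: "compact D"
  obtains S M l where "S \<subseteq> F" "\<And>g. g \<in> F \<Longrightarrow> M g \<ge> (2::int)"
    "\<And>g. g \<in> F \<Longrightarrow> l g \<in> supported S" "\<And>s. s \<in> S \<Longrightarrow> l s = 0"
    "\<And>g. g \<in> F - S \<Longrightarrow> int_mult (M g) g - int_comb F (l g) \<in> V"
    "\<And>c. c \<in> supported S \<Longrightarrow> int_comb F (\<lambda>g. M g * c g) \<in> D \<Longrightarrow> int_comb F (\<lambda>g. M g * c g) = 0"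
proof -
  let ?\<S> = "{S. S \<subseteq> F \<and> discretely_independent F S}"
  have "{} \<in> ?\<S>"
    by (auto simp: discretely_independent_def supported_def fun_eq_iff intro!: exI[of _ UNIV])
  moreover have "finite ?\<S>" using F by simp
  ultimately obtain S where S: "S \<in> ?\<S>" and max: "\<And>S'. S' \<in> ?\<S> \<Longrightarrow> S \<subseteq> S' \<Longrightarrow> S' = S"
    using finite_has_maximal[of ?\<S>] by (metis (lifting) empty_iff)
  have "\<exists>m l. m \<ge> 2 \<and> l \<in> supported S \<and> int_mult m g - int_comb F l \<in> V" if "g \<in> F - S" for g
    using that S max[of "insert g S"] F V by (intro discretely_independent_recurrence) auto
  then obtain m k where mk: "\<And>g. g \<in> F - S \<Longrightarrow>
      m g \<ge> 2 \<and> k g \<in> supported S \<and> int_mult (m g) g - int_comb F (k g) \<in> V"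
    by metis
  have "finite S" using S F finite_subset by blast
  define Y where "Y = {y \<in> supported S. int_comb F y \<in> D}"
  have "finite Y" unfolding Y_def using S D by (intro discretely_independent_finite_compact) auto
  \<comment> \<open>By discreteness only finitely many vectors on \<open>S\<close> map into
    \<open>D\<close>; \<open>N\<close> exceeds all their coordinates there, and the summand 2
    secures the lower bound on the moduli.\<close>
  define N where "N = 2 + (\<Sum>y\<in>Y. \<Sum>s\<in>S. \<bar>y s\<bar>)"
  have N2: "N \<ge> 2" unfolding N_def by (simp add: sum_nonneg)
  have N: "\<bar>y s\<bar> < N" if "y \<in> Y" "s \<in> S" for y s
  proof -
    have "\<bar>y s\<bar> \<le> (\<Sum>s\<in>S. \<bar>y s\<bar>)"
      using \<open>finite S\<close> that by (intro member_le_sum) auto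
    also have "\<dots> \<le> (\<Sum>y\<in>Y. \<Sum>s\<in>S. \<bar>y s\<bar>)"
      using \<open>finite Y\<close> that by (intro member_le_sum[of y Y "\<lambda>y. \<Sum>s\<in>S. \<bar>y s\<bar>"]) (auto simp: sum_nonneg)
    finally show ?thesis by (simp add: N_def)
  qed
  define M where "M g = (if g \<in> S then N else m g)" for g
  define l where "l g = (if g \<in> S then 0 else k g)" for g
  show thesis
  proof (rule that[of S M l])
    show "int_comb F (\<lambda>g. M g * c g) = 0"
      if c: "c \<in> supported S" and *: "int_comb F (\<lambda>g. M g * c g) \<in> D" for c
    proof -
      \<comment> \<open>On \<open>S\<close> every modulus is \<open>N\<close>, so the coordinates
        are multiples of \<open>N\<close> of absolute value below \<open>N\<close>, hence
        zero.\<close>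
      have "(\<lambda>g. M g * c g) \<in> Y" using c * by (auto simp: Y_def supported_def)
      then have "\<bar>N * c s\<bar> < N" if "s \<in> S" for s
        using N that by (fastforce simp: M_def)
      then have "c s = 0" if "s \<in> S" for s
        using N2 that by (fastforce simp: abs_mult)
      then have "(\<lambda>g. M g * c g) = 0" using c by (auto simp: supported_def fun_eq_iff)
      then show ?thesis by (simp add: int_comb_0)
    qed
  qed (use S mk N2 in \<open>auto simp: M_def l_def supported_0\<close>)
qed


section \<open>Loops from transversals\<close>

text \<open>The finite quotient group \<open>P/K\<close> is carried over to representatives chosen
  in \<open>T\<close>. Since \<open>\<phi>\<close> need not be constant on cosets, representatives
  with value in \<open>C'\<close> are preferred: \<open>sep\<close> makes such values unique, so the
  estimates \<open>sum\<close> and \<open>dense\<close>, given for some representative, hold for the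
  chosen one.\<close>

lemma loop_from_transversal:
  fixes \<phi> :: "'p::ab_group_add \<Rightarrow> 'a::topological_ab_group_add"
  assumes P: "0 \<in> P" "\<And>x y. x \<in> P \<Longrightarrow> y \<in> P \<Longrightarrow> x - y \<in> P"
    and K: "K \<subseteq> P" "0 \<in> K" "\<And>x y. x \<in> K \<Longrightarrow> y \<in> K \<Longrightarrow> x - y \<in> K"
    and B: "finite B" "B \<subseteq> P" "\<And>x. x \<in> P \<Longrightarrow> \<exists>b\<in>B. x - b \<in> K"
    and T: "T \<subseteq> P" "\<And>x. x \<in> P \<Longrightarrow> \<exists>t\<in>T. x - t \<in> K"
    and sum: "\<And>a b. a \<in> T \<Longrightarrow> b \<in> T \<Longrightarrow> \<phi> a \<in> C \<Longrightarrow> \<phi> b \<in> C \<Longrightarrow>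
      \<exists>t\<in>T. a + b - t \<in> K \<and> \<phi> t \<in> C' \<and> - (\<phi> a + \<phi> b) + \<phi> t \<in> U"
    and sep: "\<And>s t. s \<in> T \<Longrightarrow> t \<in> T \<Longrightarrow> s - t \<in> K \<Longrightarrow> \<phi> s \<in> C' \<Longrightarrow> \<phi> t \<in> C' \<Longrightarrow> \<phi> s = \<phi> t"
    and dense: "\<And>x. x \<in> C \<Longrightarrow> \<exists>t\<in>T. \<phi> t \<in> C' \<and> x - \<phi> t \<in> U"
  obtains Q op where "Q \<subseteq> T" "finite Q" "is_loop Q op" "\<And>a b. a \<in> Q \<Longrightarrow> b \<in> Q \<Longrightarrow> a - b \<in> K \<Longrightarrow> a = b"
    "\<And>x. x \<in> C \<Longrightarrow> \<exists>q\<in>Q. x - \<phi> q \<in> U"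
    "\<And>a b. a \<in> Q \<Longrightarrow> b \<in> Q \<Longrightarrow> \<phi> a \<in> C \<Longrightarrow> \<phi> b \<in> C \<Longrightarrow> - (\<phi> a + \<phi> b) + \<phi> (op a b) \<in> U"
proof -
  have K_uminus: "- x \<in> K" if "x \<in> K" for x
    using K(3)[OF K(2) that] by simp
  have K_add: "x + y \<in> K" if "x \<in> K" "y \<in> K" for x y
    using K(3)[OF that(1) K_uminus[OF that(2)]] by simp
  have P_add: "x + y \<in> P" if "x \<in> P" "y \<in> P" for x y
    using P(2)[OF that(1) P(2)[OF P(1) that(2)]] by simp
  \<comment> \<open>The last clause asks for a value in \<open>C'\<close> whenever the coset has a
    representative with such a value.\<close>
  define is_rep where "is_rep x t \<longleftrightarrow> t \<in> T \<and> x - t \<in> K \<and>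
    ((\<exists>s\<in>T. x - s \<in> K \<and> \<phi> s \<in> C') \<longrightarrow> \<phi> t \<in> C')" for x t
  define rep where "rep x = (SOME t. is_rep x t)" for x
  have rep: "is_rep x (rep x)" if "x \<in> P" for x
    unfolding rep_def by (rule someI_ex) (use T(2)[OF that] in \<open>auto simp: is_rep_def\<close>)
  have rep_T: "rep x \<in> T" and rep_K: "x - rep x \<in> K" if "x \<in> P" for x
    using rep[OF that] by (auto simp: is_rep_def)
  have rep_P: "rep x \<in> P" if "x \<in> P" for x using rep_T[OF that] T(1) by blast
  \<comment> \<open>\<open>is_rep x\<close> depends only on the coset of \<open>x\<close>, so the
    choice operator selects the same element for the whole coset.\<close>
  have rep_eq: "rep x = rep y" if "x - y \<in> K" for x y
  proof -
    have "x - t \<in> K \<longleftrightarrow> y - t \<in> K" for t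
      using K(3)[OF _ that, of "x - t"] K_add[OF that, of "y - t"] by auto
    then show ?thesis unfolding rep_def is_rep_def by simp
  qed
  have rep_eqD: "x - y \<in> K" if "rep x = rep y" "x \<in> P" "y \<in> P" for x y
    using K(3)[OF rep_K[OF that(2)] rep_K[OF that(3)]] that(1) by simp
  define Q where "Q = rep ` P"
  have rep_Q: "rep q = q" if "q \<in> Q" for q
    using that rep_eq[of "rep _"] rep_K K_uminus by (force simp: Q_def)
  have Q_P: "q \<in> P" if "q \<in> Q" for q using that rep_P by (auto simp: Q_def)
  have rep_phi: "\<phi> (rep x) = \<phi> t" if "x \<in> P" "t \<in> T" "x - t \<in> K" "\<phi> t \<in> C'" for x t
  proof (rule sep)
    show "rep x - t \<in> K" using K(3)[OF that(3) rep_K[OF that(1)]] by simp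
    show "\<phi> (rep x) \<in> C'" using rep[OF that(1)] that unfolding is_rep_def by blast
  qed (use that rep_T in auto)
  define op where "op a b = rep (a + b)" for a b
  have op_comm: "op a b = op b a" for a b by (simp add: op_def add.commute)
  have op_Q: "op a b \<in> Q" if "a \<in> Q" "b \<in> Q" for a b
    using that Q_P P_add by (auto simp: op_def Q_def)
  have solve: "\<exists>!x. x \<in> Q \<and> op a x = b" if ab: "a \<in> Q" "b \<in> Q" for a b
  proof (rule ex1I)
    have P': "b - a \<in> P" using ab Q_P P(2) by blast
    have "(a + rep (b - a)) - b = - ((b - a) - rep (b - a))" by simp
    then have "(a + rep (b - a)) - b \<in> K" using K_uminus rep_K[OF P'] by metis
    then have "op a (rep (b - a)) = b" using rep_eq rep_Q[OF ab(2)] unfolding op_def by metis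
    then show "rep (b - a) \<in> Q \<and> op a (rep (b - a)) = b" using P' by (auto simp: Q_def)
    fix x assume x: "x \<in> Q \<and> op a x = b"
    then have "rep (a + x) = rep b" using rep_Q[OF ab(2)] by (simp add: op_def)
    then have "a + x - b \<in> K" using rep_eqD x ab Q_P P_add by blast
    then have "x - (b - a) \<in> K" by (simp add: algebra_simps)
    then show "x = rep (b - a)" using rep_eq rep_Q x by metis
  qed
  have unit: "op a (rep 0) = a" if "a \<in> Q" for a
  proof -
    have "a + rep 0 - a = - (0 - rep 0)" by simp
    then have "a + rep 0 - a \<in> K" using K_uminus rep_K[OF P(1)] by metis
    then show ?thesis using rep_eq rep_Q[OF that] unfolding op_def by metis
  qed
  show thesis
  proof (rule that[of Q op])
    show "Q \<subseteq> T" using rep_T by (auto simp: Q_def)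
    \<comment> \<open>Each coset meets the finite set \<open>B\<close>, and \<open>rep\<close> is
      constant on cosets.\<close>
    have "Q \<subseteq> rep ` B" using B(3) rep_eq by (fastforce simp: Q_def)
    then show "finite Q" using B(1) finite_surj by blast
    show "is_loop Q op"
      unfolding is_loop_def
    proof (intro conjI ballI)
      show "\<exists>!x. x \<in> Q \<and> op x a = b" if "a \<in> Q" "b \<in> Q" for a b
        using solve[OF that] by (simp add: op_comm)
      show "\<exists>e\<in>Q. \<forall>a\<in>Q. op a e = a \<and> op e a = a"
      proof (intro bexI[of _ "rep 0"] ballI)
        show "op a (rep 0) = a \<and> op (rep 0) a = a" if "a \<in> Q" for a
          using unit[OF that] op_comm[of a "rep 0"] by simp
      qed (use P(1) in \<open>auto simp: Q_def\<close>)
    qed (use op_Q solve in auto)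
    show "a = b" if "a \<in> Q" "b \<in> Q" "a - b \<in> K" for a b
      using rep_eq[OF that(3)] rep_Q that by metis
    show "\<exists>q\<in>Q. x - \<phi> q \<in> U" if x: "x \<in> C" for x
    proof -
      obtain t where t: "t \<in> T" "\<phi> t \<in> C'" "x - \<phi> t \<in> U" using dense[OF x] by blast
      then have "\<phi> (rep t) = \<phi> t" using T(1) K(2) by (intro rep_phi) auto
      then show ?thesis using t T(1) by (intro bexI[of _ "rep t"]) (auto simp: Q_def)
    qed
    show "- (\<phi> a + \<phi> b) + \<phi> (op a b) \<in> U" if ab: "a \<in> Q" "b \<in> Q" "\<phi> a \<in> C" "\<phi> b \<in> C" for a b
    proof -
      have "a \<in> T" "b \<in> T" using ab rep_T by (auto simp: Q_def)
      then obtain t where t: "t \<in> T" "a + b - t \<in> K" "\<phi> t \<in> C'" "- (\<phi> a + \<phi> b) + \<phi> t \<in> U"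
        using sum ab by blast
      then have "\<phi> (op a b) = \<phi> t"
        unfolding op_def using ab Q_P P_add by (intro rep_phi) auto
      then show ?thesis using t by simp
    qed
  qed
qed

section \<open>Transport to natural numbers and injective perturbation\<close>

text \<open>Transport of structure along a bijection of \<open>Q\<close> with an initial segment of
  the naturals, as approximability is stated for such carriers.\<close>

lemma loop_approximation_nat:
  fixes Q :: "'q set"
  assumes "loop_approximation C U Q op j"
  shows "\<exists>(Q'::nat set) op' j'. loop_approximation C U Q' op' j'"
proof -
  have "finite Q" using assms by (simp add: loop_approximation_def)
  then obtain h where h: "bij_betw h {0..<card Q} Q"
    using ex_bij_betw_nat_finite by blast
  define k where "k = inv_into {0..<card Q} h"
  let ?N = "{0..<card Q}"
  have hQ: "h n \<in> Q" if "n \<in> ?N" for n using h that bij_betwE by blast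
  have kN: "k q \<in> ?N" if "q \<in> Q" for q
    using bij_betwE[OF bij_betw_inv_into[OF h]] that by (auto simp: k_def)
  have hk: "h (k q) = q" if "q \<in> Q" for q
    using bij_betw_inv_into_right[OF h that] by (simp add: k_def)
  have kh: "k (h n) = n" if "n \<in> ?N" for n
    using bij_betw_inv_into_left[OF h that] by (simp add: k_def)
  define op' where "op' a b = k (op (h a) (h b))" for a b
  have L: "is_loop Q op" using assms by (simp add: loop_approximation_def)
  have opQ: "op a b \<in> Q" if "a \<in> Q" "b \<in> Q" for a b using L that by (simp add: is_loop_def)
  have "is_loop ?N op'"
    unfolding is_loop_def
  proof (intro conjI ballI)
    show "op' a b \<in> ?N" if "a \<in> ?N" "b \<in> ?N" for a b
      using that opQ kN hQ unfolding op'_def by blast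
    show "\<exists>!x. x \<in> ?N \<and> op' a x = b" if ab: "a \<in> ?N" "b \<in> ?N" for a b
    proof -
      have "\<exists>!x. x \<in> Q \<and> op (h a) x = h b" using L hQ ab by (simp add: is_loop_def)
      then obtain x where x: "x \<in> Q" "op (h a) x = h b"
        and u: "\<And>y. y \<in> Q \<Longrightarrow> op (h a) y = h b \<Longrightarrow> y = x" by blast
      show ?thesis
      proof (rule ex1I[of _ "k x"])
        show "k x \<in> ?N \<and> op' a (k x) = b" using x kN hk kh ab by (simp add: op'_def)
        fix y assume y: "y \<in> ?N \<and> op' a y = b"
        then have "op (h a) (h y) = h b" using hk opQ hQ ab unfolding op'_def by metis
        then show "y = k x" using u hQ kh y by metis
      qed
    qed
    show "\<exists>!x. x \<in> ?N \<and> op' x a = b" if ab: "a \<in> ?N" "b \<in> ?N" for a b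
    proof -
      have "\<exists>!x. x \<in> Q \<and> op x (h a) = h b" using L hQ ab by (simp add: is_loop_def)
      then obtain x where x: "x \<in> Q" "op x (h a) = h b"
        and u: "\<And>y. y \<in> Q \<Longrightarrow> op y (h a) = h b \<Longrightarrow> y = x" by blast
      show ?thesis
      proof (rule ex1I[of _ "k x"])
        show "k x \<in> ?N \<and> op' (k x) a = b" using x kN hk kh ab by (simp add: op'_def)
        fix y assume y: "y \<in> ?N \<and> op' y a = b"
        then have "op (h y) (h a) = h b" using hk opQ hQ ab unfolding op'_def by metis
        then show "y = k x" using u hQ kh y by metis
      qed
    qed
    have "\<exists>e\<in>Q. \<forall>a\<in>Q. op a e = a \<and> op e a = a"
      using L by (simp add: is_loop_def)
    then obtain e where e: "e \<in> Q" "\<And>a. a \<in> Q \<Longrightarrow> op a e = a \<and> op e a = a"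
      by blast
    show "\<exists>e\<in>?N. \<forall>a\<in>?N. op' a e = a \<and> op' e a = a"
      using e kN hk kh hQ by (intro bexI[of _ "k e"] ballI) (simp_all add: op'_def)
  qed
  moreover have "inj_on (j \<circ> h) ?N"
    using assms h by (intro comp_inj_on) (auto simp: loop_approximation_def bij_betw_def)
  moreover have "(j \<circ> h) ` ?N = j ` Q"
    using bij_betw_imp_surj_on[OF h] by (metis image_comp)
  moreover have "- (j (h a) + j (h b)) + j (h (op' a b)) \<in> U"
    if "a \<in> ?N" "b \<in> ?N" "j (h a) \<in> C" "j (h b) \<in> C" for a b
    using assms that hQ hk opQ unfolding loop_approximation_def op'_def by metis
  ultimately have "loop_approximation C U ?N op' (j \<circ> h)"
    using assms by (simp add: loop_approximation_def)
  then show ?thesis by blast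
qed

text \<open>Greedy choice: an infinite set keeps a point after the finitely many values used so far
  are removed.\<close>

lemma injective_choice:
  assumes "finite Q" "\<And>q. q \<in> Q \<Longrightarrow> infinite (A q)"
  shows "\<exists>j. inj_on j Q \<and> (\<forall>q\<in>Q. j q \<in> A q)"
  using assms
proof (induction Q rule: finite_induct)
  case (insert a Q)
  then obtain j where j: "inj_on j Q" "\<forall>q\<in>Q. j q \<in> A q" by auto
  have "infinite (A a - j ` Q)" using insert by simp
  then obtain x where "x \<in> A a" "x \<notin> j ` Q" by (metis Diff_iff finite.emptyI equals0I)
  with j insert.hyps show ?case
    by (intro exI[of _ "j(a := x)"]) (auto simp: inj_on_def)
qed simp

text \<open>Finite sets are closed in a Hausdorff space, so a finite open neighbourhood of
  \<open>0\<close> would make \<open>{0}\<close> open; translation passes from \<open>0\<close> to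
  \<open>a\<close>.\<close>

lemma open_infinite_of_nondiscrete:
  fixes Y :: "'a::{topological_ab_group_add, t2_space} set"
  assumes "\<not> open {0::'a}" "open Y" "0 \<in> Y"
  shows "infinite {x. x - a \<in> Y}"
proof
  assume "finite {x. x - a \<in> Y}"
  then have "finite ((\<lambda>x. x - a) ` {x. x - a \<in> Y})" by simp
  moreover have "y \<in> (\<lambda>x. x - a) ` {x. x - a \<in> Y}" if "y \<in> Y" for y
    using that by (intro image_eqI[of _ _ "y + a"]) auto
  ultimately have "finite Y" by (meson finite_subset subsetI)
  then have "open (Y - (Y - {0}))" using assms(2) by (intro open_Diff finite_imp_closed) auto
  moreover have "Y - (Y - {0}) = {0}" using assms(3) by auto
  ultimately show False using assms(1) by simp
qed

section \<open>Approximation by finite abelian groups\<close>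

text \<open>Local compactness enters through \<open>Z\<close>: the errors of reduction stay in
  \<open>N\<close>, so reduced sums of elements of \<open>C\<close> have values in the compact set
  \<open>C + C + Z\<close>, where a large modulus separates them.\<close>

lemma noninjective_loop_approximation:
  fixes C U N Z :: "'a::topological_ab_group_add set"
  assumes Z: "open N" "0 \<in> N" "N \<subseteq> Z" "compact Z" and C: "compact C" and U: "open U" "0 \<in> U"
  obtains Q :: "('a \<Rightarrow> int) set" and op j where "finite Q" "is_loop Q op"
    "\<And>x. x \<in> C \<Longrightarrow> \<exists>q\<in>Q. x - j q \<in> U"
    "\<And>a b. a \<in> Q \<Longrightarrow> b \<in> Q \<Longrightarrow> j a \<in> C \<Longrightarrow> j b \<in> C \<Longrightarrow> - (j a + j b) + j (op a b) \<in> U"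
    "open {0::'a} \<Longrightarrow> inj_on j Q"
proof -
  obtain F where F: "finite F" "F \<subseteq> C" "\<And>x. x \<in> C \<Longrightarrow> \<exists>f\<in>F. x - f \<in> U"
    by (rule compact_finite_net[OF C U]) blast
  \<comment> \<open>\<open>V0\<close> is so small that one error for each element of
    \<open>F\<close> still adds up to an error in both \<open>U\<close> and
    \<open>N\<close>.\<close>
  have "open (U \<inter> N)" "0 \<in> U \<inter> N" using U Z by auto
  then obtain V0 where V0: "open V0" "0 \<in> V0" "\<forall>x\<in>V0. - x \<in> V0"
    "\<forall>v. (\<forall>i\<in>F. v i \<in> V0) \<longrightarrow> (\<Sum>i\<in>F. v i) \<in> U \<inter> N"
    using nhd_zero_sum[OF F(1)] by metis
  \<comment> \<open>In a discrete group the relations off \<open>S\<close> are made exact.\<close>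
  define V where "V = (if open {0::'a} then {0} else V0)"
  have V: "open V" "0 \<in> V" "V \<subseteq> V0" using V0 by (auto simp: V_def)
  \<comment> \<open>All values to be told apart lie here: those of the net inside \<open>C\<close>,
    and sums of two elements of \<open>C\<close> with an error in \<open>Z\<close>.\<close>
  define C' where "C' = C \<union> {x + y | x y. x \<in> {x + y | x y. x \<in> C \<and> y \<in> C} \<and> y \<in> Z}"
  have C'_sum: "x + y + z \<in> C'" if "x \<in> C" "y \<in> C" "z \<in> Z" for x y z
    using that unfolding C'_def by blast
  have "compact C'" unfolding C'_def by (intro compact_Un compact_set_plus C Z)
  then have D: "compact {x - y | x y. x \<in> C' \<and> y \<in> C'}" by (intro compact_set_minus)
  obtain S M l where S: "S \<subseteq> F" and M: "\<And>g. g \<in> F \<Longrightarrow> M g \<ge> (2::int)"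
    and l: "\<And>g. g \<in> F \<Longrightarrow> l g \<in> supported S" and l0: "\<And>s. s \<in> S \<Longrightarrow> l s = 0"
    and rel: "\<And>g. g \<in> F - S \<Longrightarrow> int_mult (M g) g - int_comb F (l g) \<in> V"
    and M_sep: "\<And>c. c \<in> supported S \<Longrightarrow> int_comb F (\<lambda>g. M g * c g) \<in> {x - y | x y. x \<in> C' \<and> y \<in> C'}
      \<Longrightarrow> int_comb F (\<lambda>g. M g * c g) = 0"
    by (rule exists_relations[OF F(1) V(1,2) D]) (rule that)
  let ?r = "relator F M l" and ?\<phi> = "int_comb F"
  define B where "B = {b \<in> supported F. \<forall>g\<in>F. 0 \<le> b g \<and> b g < M g}"
  have B: "finite B" "B \<subseteq> supported F"
    using finite_box[OF F(1)] by (auto simp: B_def)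
  have r_supp: "?r c \<in> supported F" if "c \<in> supported F" for c
    using that l S supported_mono by (intro relator_supported) blast+
  have box: "\<exists>b\<in>B. \<exists>c\<in>supported F. x - b = ?r c" if x: "x \<in> supported F" for x
  proof -
    have M0: "M g > 0" if "g \<in> F" for g using M[OF that] by simp
    obtain c where c: "c \<in> supported F"
      "\<forall>g\<in>F. 0 \<le> (x - ?r c) g \<and> (x - ?r c) g < M g"
      by (rule bexE[OF relator_box[OF F(1) S M0 l l0 x]])
    then have "x - ?r c \<in> B"
      unfolding B_def by (intro CollectI conjI supported_diff x r_supp)
    then show ?thesis using c by (intro bexI[of _ "x - ?r c"] bexI[of _ c]) auto
  qed
  have r_off: "?r c g = M g * c g" if "g \<in> F - S" for c g
    using that l by (auto simp: relator_def supported_def intro!: sum.neutral)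
  have r_S: "?r c = (\<lambda>g. M g * c g)" if "c \<in> supported S" for c
  proof -
    have "c h * l h g = 0" for h g using that l0 by (cases "h \<in> S") (auto simp: supported_def)
    then show ?thesis unfolding relator_def by (simp del: mult_eq_0_iff)
  qed
  \<comment> \<open>Taking the difference set of \<open>C'\<close> as \<open>D\<close> means that no
    nonzero image of a relator supported on \<open>S\<close> links two values in
    \<open>C'\<close>.\<close>
  have r_sep: "x = y" if "c \<in> supported S" "x - y = ?\<phi> (?r c)" "x \<in> C'" "y \<in> C'" for c x y
  proof -
    have "x - y \<in> {x - y | x y. x \<in> C' \<and> y \<in> C'}" using that by blast
    then have "x - y = 0" using M_sep[OF that(1)] unfolding that(2) r_S[OF that(1)] by blast
    then show ?thesis by simp
  qed
  have single: "(\<lambda>h. if h = f then 1 else 0) \<in> supported F" "?\<phi> (\<lambda>h. if h = f then 1 else 0) = f"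
    if "f \<in> F" for f
    using that F(1) by (auto simp: supported_def int_comb_single int_mult.scale_one)
  show thesis
  proof (cases "open {0::'a}")
    case True
    then have rel0: "int_mult (M g) g - ?\<phi> (l g) = 0" if "g \<in> F - S" for g
      using rel[OF that] by (simp add: V_def)
    \<comment> \<open>This is the relation group enlarged by the kernel of
      \<open>int_comb F\<close>, so distinct representatives have distinct images. With exact
      relations off \<open>S\<close>, all of \<open>supported F\<close> can serve as
      \<open>T\<close>.\<close>
    define K where "K = {x \<in> supported F. \<exists>c\<in>supported F. ?\<phi> x = ?\<phi> (?r c)}"
    obtain Q op where Q: "Q \<subseteq> supported F" "finite Q" "is_loop Q op"
      "\<And>a b. a \<in> Q \<Longrightarrow> b \<in> Q \<Longrightarrow> a - b \<in> K \<Longrightarrow> a = b"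
      "\<And>x. x \<in> C \<Longrightarrow> \<exists>q\<in>Q. x - ?\<phi> q \<in> U"
      "\<And>a b. a \<in> Q \<Longrightarrow> b \<in> Q \<Longrightarrow> ?\<phi> a \<in> C \<Longrightarrow> ?\<phi> b \<in> C \<Longrightarrow> - (?\<phi> a + ?\<phi> b) + ?\<phi> (op a b) \<in> U"
    proof (rule loop_from_transversal[where P = "supported F" and K = K and B = B
          and T = "supported F" and \<phi> = ?\<phi> and C = C and C' = C' and U = U])
      have K0: "0 \<in> K"
        unfolding K_def using supported_0[of F]
        by (intro CollectI conjI bexI[of _ 0]) (simp_all add: relator_0)
      then show "0 \<in> K" .
      show "x - y \<in> K" if xy: "x \<in> K" "y \<in> K" for x y
      proof -
        obtain c d where cd: "c \<in> supported F" "?\<phi> x = ?\<phi> (?r c)" "d \<in> supported F" "?\<phi> y = ?\<phi> (?r d)"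
          using xy unfolding K_def by blast
        then have "?\<phi> (x - y) = ?\<phi> (?r (c - d))" by (simp add: int_comb_diff relator_diff)
        then show ?thesis using xy cd supported_diff unfolding K_def by blast
      qed
      show "\<exists>b\<in>B. x - b \<in> K" if "x \<in> supported F" for x
      proof -
        obtain b c where bc: "b \<in> B" "c \<in> supported F" "x - b = ?r c" using box[OF \<open>x \<in> supported F\<close>] by blast
        then have "x - b \<in> K" using r_supp unfolding K_def by auto
        then show ?thesis using bc by blast
      qed
      show "\<exists>t\<in>supported F. x - t \<in> K" if "x \<in> supported F" for x
        using that K0 by (intro bexI[of _ x]) auto
      show "\<exists>t\<in>supported F. a + b - t \<in> K \<and> ?\<phi> t \<in> C' \<and> - (?\<phi> a + ?\<phi> b) + ?\<phi> t \<in> U"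
        if "a \<in> supported F" "b \<in> supported F" "?\<phi> a \<in> C" "?\<phi> b \<in> C" for a b
        using that K0 U(2) C'_sum[of "?\<phi> a" "?\<phi> b" 0] Z supported_add
        by (intro bexI[of _ "a + b"]) (auto simp: int_comb_add)
      show "?\<phi> s = ?\<phi> t" if st: "s - t \<in> K" "?\<phi> s \<in> C'" "?\<phi> t \<in> C'" for s t
      proof -
        obtain c where c: "c \<in> supported F" "?\<phi> (s - t) = ?\<phi> (?r c)"
          using st(1) unfolding K_def by blast
        \<comment> \<open>Relations off \<open>S\<close> have zero defect, so dropping their
          coefficients leaves the image unchanged.\<close>
        define d where "d = (\<lambda>g. if g \<in> S then c g else 0)"
        have "?\<phi> (?r c) = ?\<phi> (?r d)"
          unfolding int_comb_relator[OF F(1)]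
          by (rule sum.cong) (use rel0 in \<open>auto simp: d_def\<close>)
        moreover have "d \<in> supported S" by (simp add: d_def supported_def)
        moreover have "?\<phi> s - ?\<phi> t = ?\<phi> (?r c)" using c(2) by (simp add: int_comb_diff)
        ultimately show ?thesis using r_sep[of d "?\<phi> s" "?\<phi> t"] st by simp
      qed
      show "\<exists>t\<in>supported F. ?\<phi> t \<in> C' \<and> x - ?\<phi> t \<in> U" if "x \<in> C" for x
      proof -
        obtain f where f: "f \<in> F" "x - f \<in> U" using F(3)[OF \<open>x \<in> C\<close>] by blast
        then show ?thesis using single[OF f(1)] F(2)
          by (intro bexI[of _ "\<lambda>h. if h = f then 1 else 0"]) (auto simp: C'_def)
      qed
    qed (use B supported_0 supported_diff in \<open>auto simp: K_def\<close>)
    show thesis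
    proof (rule that[of Q op ?\<phi>])
      show "inj_on ?\<phi> Q"
      proof (rule inj_onI)
        fix a b assume ab: "a \<in> Q" "b \<in> Q" "?\<phi> a = ?\<phi> b"
        then have "?\<phi> (a - b) = ?\<phi> (?r 0)" by (simp add: int_comb_diff relator_0 int_comb_0)
        then have "a - b \<in> K" using ab Q(1) supported_diff supported_0 unfolding K_def by blast
        then show "a = b" using Q(4) ab by blast
      qed
    qed (use Q in auto)
  next
    case False
    define K where "K = ?r ` supported F"
    \<comment> \<open>Only coordinates off \<open>S\<close> are reduced; those in \<open>S\<close>
      stay free, since reducing them could move the image far.\<close>
    define T where "T = {x \<in> supported F. \<forall>g\<in>F - S. 0 \<le> x g \<and> x g < M g}"
    obtain Q op where Q: "finite Q" "is_loop Q op"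
      "\<And>x. x \<in> C \<Longrightarrow> \<exists>q\<in>Q. x - ?\<phi> q \<in> U"
      "\<And>a b. a \<in> Q \<Longrightarrow> b \<in> Q \<Longrightarrow> ?\<phi> a \<in> C \<Longrightarrow> ?\<phi> b \<in> C \<Longrightarrow> - (?\<phi> a + ?\<phi> b) + ?\<phi> (op a b) \<in> U"
    proof (rule loop_from_transversal[where P = "supported F" and K = K and B = B
          and T = T and \<phi> = ?\<phi> and C = C and C' = C' and U = U])
      show "0 \<in> K"
        unfolding K_def by (rule image_eqI[of _ _ 0]) (simp_all add: relator_0 supported_0)
      show "x - y \<in> K" if xy: "x \<in> K" "y \<in> K" for x y
      proof -
        obtain c d where cd: "c \<in> supported F" "x = ?r c" "d \<in> supported F" "y = ?r d"
          using xy unfolding K_def by blast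
        then have "x - y = ?r (c - d)" by (simp add: relator_diff)
        then show ?thesis using cd supported_diff unfolding K_def by blast
      qed
      show "\<exists>b\<in>B. x - b \<in> K" if "x \<in> supported F" for x
        using box[OF that] unfolding K_def by (metis imageI)
      moreover have "B \<subseteq> T" by (auto simp: B_def T_def)
      ultimately show "\<exists>t\<in>T. x - t \<in> K" if "x \<in> supported F" for x
        using that by blast
      show "\<exists>t\<in>T. a + b - t \<in> K \<and> ?\<phi> t \<in> C' \<and> - (?\<phi> a + ?\<phi> b) + ?\<phi> t \<in> U"
        if ab: "a \<in> T" "b \<in> T" "?\<phi> a \<in> C" "?\<phi> b \<in> C" for a b
      proof -
        \<comment> \<open>Each coordinate off \<open>S\<close> carries at most once, so the error is a sum of at most
          \<open>card F\<close> elements of \<open>V\<close>, independently of the moduli \<open>M\<close>.\<close>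
        define c where "c g = (if g \<in> F - S then (a g + b g) div M g else 0)" for g
        have c: "c \<in> supported F" by (simp add: c_def supported_def)
        have c01: "c g = 0 \<or> c g = 1" if "g \<in> F - S" for g
        proof -
          have "0 \<le> a g" "a g < M g" "0 \<le> b g" "b g < M g" "M g \<ge> 2"
            using that ab(1,2) M[of g] by (auto simp: T_def)
          then have "0 \<le> a g + b g" "a g + b g < 2 * M g" "M g > 0" by linarith+
          moreover from this have "M g * ((a g + b g) div M g) \<le> a g + b g"
            using pos_mod_sign[of "M g" "a g + b g"] by (simp flip: minus_mult_div_eq_mod)
          ultimately have "0 \<le> (a g + b g) div M g" "M g * ((a g + b g) div M g) < M g * 2"
            by (simp add: pos_imp_zdiv_nonneg_iff, linarith)
          then have "0 \<le> (a g + b g) div M g" "(a g + b g) div M g < 2"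
            using \<open>M g > 0\<close> by simp_all
          then show ?thesis using that by (auto simp: c_def)
        qed
        define t where "t = a + b - ?r c"
        have "t \<in> supported F"
          using ab c r_supp supported_add supported_diff unfolding t_def T_def by blast
        moreover have "t g = (a g + b g) mod M g" if "g \<in> F - S" for g
          using that r_off[OF that, of c]
          by (simp add: t_def c_def minus_mult_div_eq_mod[symmetric])
        moreover have "M g > 0" if "g \<in> F - S" for g using M[of g] that by simp
        ultimately have tT: "t \<in> T" by (simp add: T_def)
        define v where "v h = - int_mult (c h) (int_mult (M h) h - ?\<phi> (l h))" for h
        have "v h \<in> V0" if "h \<in> F" for h
        proof (cases "h \<in> S")
          case True
          then show ?thesis using V0(2) by (simp add: v_def c_def)
        next
          case False
          then have "- (int_mult (M h) h - ?\<phi> (l h)) \<in> V0" using that rel[of h] V(3) V0(3) by blast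
          then show ?thesis using False that c01[of h] V0(2) by (auto simp: v_def)
        qed
        then have "(\<Sum>h\<in>F. v h) \<in> U \<inter> N" using V0(4) by blast
        moreover have "?\<phi> t = ?\<phi> a + ?\<phi> b + (\<Sum>h\<in>F. v h)"
          by (simp add: t_def int_comb_diff int_comb_add int_comb_relator[OF F(1)] v_def sum_negf)
        ultimately show ?thesis
          using tT c C'_sum[OF ab(3,4)] Z by (intro bexI[of _ t]) (auto simp: t_def K_def)
      qed
      show "?\<phi> s = ?\<phi> t" if st: "s \<in> T" "t \<in> T" "s - t \<in> K" "?\<phi> s \<in> C'" "?\<phi> t \<in> C'" for s t
      proof -
        obtain c where c: "c \<in> supported F" "s - t = ?r c" using st unfolding K_def by blast
        \<comment> \<open>Two reduced coordinates differ by less than \<open>M g\<close>, while the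
          relator makes their difference a multiple of \<open>M g\<close>. Only relations in
          \<open>S\<close> remain, to which \<open>r_sep\<close> applies.\<close>
        have "c g = 0" if "g \<in> F - S" for g
        proof -
          have "s g - t g = M g * c g"
            using r_off[OF that, of c] c(2) by (metis minus_apply)
          moreover have "0 \<le> s g" "s g < M g" "0 \<le> t g" "t g < M g"
            using st(1,2) that by (auto simp: T_def)
          then have "\<bar>s g - t g\<bar> < M g" by linarith
          ultimately have "\<bar>M g\<bar> * \<bar>c g\<bar> < \<bar>M g\<bar> * 1" using M[of g] that by (simp add: abs_mult)
          then show ?thesis by (subst (asm) mult_less_cancel_left) auto
        qed
        then have "c \<in> supported S" using c(1) by (auto simp: supported_def)
        moreover have "?\<phi> s - ?\<phi> t = ?\<phi> (?r c)" using c(2) by (simp flip: int_comb_diff)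
        ultimately show ?thesis using r_sep[of c "?\<phi> s" "?\<phi> t"] st by simp
      qed
      show "\<exists>t\<in>T. ?\<phi> t \<in> C' \<and> x - ?\<phi> t \<in> U" if "x \<in> C" for x
      proof -
        obtain f where f: "f \<in> F" "x - f \<in> U" using F(3)[OF \<open>x \<in> C\<close>] by blast
        \<comment> \<open>The unit vector at \<open>f\<close> is reduced because all moduli are at
          least 2.\<close>
        have "(\<lambda>h. if h = f then 1 else 0) \<in> T"
          using single(1)[OF f(1)] M by (fastforce simp: T_def)
        then show ?thesis using f single(2)[OF f(1)] F(2)
          by (intro bexI[of _ "\<lambda>h. if h = f then 1 else 0"]) (auto simp: C'_def)
      qed
    qed (use B supported_0 supported_diff r_supp in \<open>auto simp: K_def T_def\<close>)
    show thesis
      by (rule that[of Q op ?\<phi>]) (use Q False in auto)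
  qed
qed

section \<open>Injective maps for discrete and nondiscrete groups\<close>

theorem theorem7:
  assumes "locally_compact_space (euclidean :: 'a::{topological_ab_group_add, t2_space} topology)"
  shows "approximable_by_finite_loops TYPE('a)"
  unfolding approximable_by_finite_loops_def
proof (intro allI impI, elim conjE)
  fix C U :: "'a set"
  assume C: "compact C" and "is_nhd U 0"
  then obtain U0 where U0: "open U0" "0 \<in> U0" "U0 \<subseteq> U" by (auto simp: is_nhd_def)
  have "\<exists>N Z. open N \<and> compact Z \<and> (0::'a) \<in> N \<and> N \<subseteq> Z"
    using assms unfolding locally_compact_space_def by simp
  then obtain N Z :: "'a set" where Z: "open N" "0 \<in> N" "N \<subseteq> Z" "compact Z"
    by blast
  show "\<exists>(Q::nat set) op j. loop_approximation C U Q op j"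
  proof (cases "open {0::'a}")
    case True
    obtain Q :: "('a \<Rightarrow> int) set" and op j where Q: "finite Q" "is_loop Q op"
      "\<And>x. x \<in> C \<Longrightarrow> \<exists>q\<in>Q. x - j q \<in> U0"
      "\<And>a b. a \<in> Q \<Longrightarrow> b \<in> Q \<Longrightarrow> j a \<in> C \<Longrightarrow> j b \<in> C \<Longrightarrow> - (j a + j b) + j (op a b) \<in> U0"
      "open {0::'a} \<Longrightarrow> inj_on j Q"
      by (rule noninjective_loop_approximation[OF Z C U0(1,2)]) blast
    have "C \<subseteq> {x + u | x u. x \<in> j ` Q \<and> u \<in> U}"
    proof
      fix x assume "x \<in> C"
      then obtain q where "q \<in> Q" "x - j q \<in> U" using Q(3) U0(3) by blast
      then show "x \<in> {x + u | x u. x \<in> j ` Q \<and> u \<in> U}"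
        by (intro CollectI exI[of _ "j q"] exI[of _ "x - j q"]) auto
    qed
    then have "loop_approximation C U Q op j"
      using Q True U0(3) by (auto simp: loop_approximation_def)
    then show ?thesis by (rule loop_approximation_nat)
  next
    case False
    \<comment> \<open>The final error is a sum of four elements of \<open>Y\<close>: the defect of
      the loop product and the perturbations at \<open>a\<close>, \<open>b\<close> and
      \<open>op a b\<close>. Two halvings keep it in \<open>U0\<close>.\<close>
    obtain H where H: "open H" "0 \<in> H" "\<And>x y. x \<in> H \<Longrightarrow> y \<in> H \<Longrightarrow> x + y \<in> U0"
      by (rule nhd_zero_halving[OF U0(1,2)]) blast
    have "open (H \<inter> N)" "0 \<in> H \<inter> N" using H Z by auto
    then obtain Y where Y: "open Y" "0 \<in> Y" "\<And>x. x \<in> Y \<Longrightarrow> - x \<in> Y"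
      "\<And>x y. x \<in> Y \<Longrightarrow> y \<in> Y \<Longrightarrow> x + y \<in> H \<inter> N"
      by (rule nhd_zero_halving) blast
    have YZ: "Y \<subseteq> Z" using Y(2) Y(4)[of _ 0] Z(3) by auto
    have HU: "H \<subseteq> U" using H(2) H(3)[of _ 0] U0(3) by auto
    \<comment> \<open>If the perturbed point \<open>j q\<close> lies in \<open>C\<close>, then
      \<open>i q\<close> is only known to lie in \<open>C + Y\<close>; hence the approximation is
      made for the larger set \<open>C1\<close>.\<close>
    define C1 where "C1 = {x + y | x y. x \<in> C \<and> y \<in> Z}"
    have C1: "compact C1" unfolding C1_def using C Z by (intro compact_set_plus)
    obtain Q :: "('a \<Rightarrow> int) set" and op i where Q: "finite Q" "is_loop Q op"
      "\<And>x. x \<in> C1 \<Longrightarrow> \<exists>q\<in>Q. x - i q \<in> Y"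
      "\<And>a b. a \<in> Q \<Longrightarrow> b \<in> Q \<Longrightarrow> i a \<in> C1 \<Longrightarrow> i b \<in> C1 \<Longrightarrow> - (i a + i b) + i (op a b) \<in> Y"
      by (rule noninjective_loop_approximation[OF Z C1 Y(1,2)]) blast
    \<comment> \<open>In a nondiscrete group each translate of \<open>Y\<close> is infinite, which
      leaves room for pairwise distinct values near the old ones.\<close>
    have "infinite {x. x - i q \<in> Y}" for q
      by (rule open_infinite_of_nondiscrete[OF False Y(1,2)])
    then obtain j where j: "inj_on j Q" "\<And>q. q \<in> Q \<Longrightarrow> j q - i q \<in> Y"
      using injective_choice[OF Q(1), of "\<lambda>q. {x. x - i q \<in> Y}"] by auto
    have j': "i q - j q \<in> Y" if "q \<in> Q" for q
      using Y(3)[OF j(2)[OF that]] by simp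
    have "C \<subseteq> {x + u | x u. x \<in> j ` Q \<and> u \<in> U}"
    proof
      fix x assume "x \<in> C"
      then have "x + 0 \<in> C1" using Z unfolding C1_def by blast
      then obtain q where q: "q \<in> Q" "x - i q \<in> Y" using Q(3) by auto
      then have "(x - i q) + (i q - j q) \<in> H \<inter> N" using Y(4) j' by blast
      then have "x - j q \<in> U" using HU by auto
      then show "x \<in> {x + u | x u. x \<in> j ` Q \<and> u \<in> U}"
        using q by (intro CollectI exI[of _ "j q"] exI[of _ "x - j q"]) auto
    qed
    moreover have "- (j a + j b) + j (op a b) \<in> U"
      if ab: "a \<in> Q" "b \<in> Q" "j a \<in> C" "j b \<in> C" for a b
    proof -
      have i: "i q \<in> C1" if "q \<in> Q" "j q \<in> C" for q
      proof -
        have "j q + (i q - j q) \<in> C1" using that j' YZ unfolding C1_def by blast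
        then show ?thesis by simp
      qed
      have "op a b \<in> Q" using Q(2) ab by (simp add: is_loop_def)
      then have "(- (i a + i b) + i (op a b)) + (j (op a b) - i (op a b)) \<in> H"
        using Y(4)[OF Q(4)[OF ab(1,2) i[OF ab(1,3)] i[OF ab(2,4)]] j(2)] by blast
      moreover have "(i a - j a) + (i b - j b) \<in> H"
        using Y(4)[OF j'[OF ab(1)] j'[OF ab(2)]] by blast
      ultimately have "((- (i a + i b) + i (op a b)) + (j (op a b) - i (op a b))) +
          ((i a - j a) + (i b - j b)) \<in> U0"
        by (rule H(3))
      moreover have "((- (i a + i b) + i (op a b)) + (j (op a b) - i (op a b))) +
          ((i a - j a) + (i b - j b)) = - (j a + j b) + j (op a b)"
        by (simp add: algebra_simps)
      ultimately show ?thesis using U0(3) by (metis subsetD)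
    qed
    ultimately have "loop_approximation C U Q op j"
      using Q j by (auto simp: loop_approximation_def)
    then show ?thesis by (rule loop_approximation_nat)
  qed
qed

end
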